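(* Let $\lambda,\eta,\mu\in\mathbb{R}$, let $\Omega\subset\mathbb{R}^2$ be open, and let $w,y,w',y'$ be smooth real-valued functions of $(x,t)\in\Omega$ satisfying on $\Omega$ the equations $$w_x+w'_x=2\eta-\tfrac1{12}(w-w')^2-\tfrac{\lambda}{12}(y-y')^2,$$ $$w_t+w'_t=\tfrac16(w-w')(w_{xx}-w'_{xx})+\tfrac{\lambda}6(y-y')(y_{xx}-y'_{xx})-\tfrac13w_x^2-\tfrac13{w'_x}^2-\tfrac13w_xw'_x-\tfrac\lambda3y_x^2-\tfrac\lambda3{y'_x}^2-\tfrac\lambda3y_xy'_x,$$ $$y_x+y'_x=2\mu-\tfrac16(w-w')(y-y'),$$ $$y_t+y'_t=\tfrac16(w-w')(y-y')_{xx}+\tfrac16(w-w')_{xx}(y-y')-\left(\tfrac23w_xy_x+\tfrac23w'_xy'_x+\tfrac13w_xy'_x+\tfrac13w'_xy_x\right).$$ If $(w',y')$ is a solution on $\Omega$ of the system $$w_t+\tfrac12w_x^2+w_{xxx}+\tfrac12\lambda y_x^2=0,\qquad y_t+w_xy_x+y_{xxx}=0$$ (that is, the system holds with $(w,y)$ replaced by $(w',y')$), then $(w,y)$ is a solution of this system on $\Omega$.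
   Context: Primes do not denote derivatives: $(w',y')$ is a second pair of functions. Subscripts $x,t$ denote partial derivatives. *)

theory Defs
  imports "HOL-Analysis.Analysis"
begin

definition partial_x :: "(real \<times> real \<Rightarrow> real) \<Rightarrow> real \<times> real \<Rightarrow> real" where
  "partial_x f p = deriv (\<lambda>s. f (s, snd p)) (fst p)"

definition partial_t :: "(real \<times> real \<Rightarrow> real) \<Rightarrow> real \<times> real \<Rightarrow> real" where
  "partial_t f p = deriv (\<lambda>s. f (fst p, s)) (snd p)"

(* Intended for open S only: derivatives are taken in the full plane, not within S. *)
primrec Ck_on :: "nat \<Rightarrow> (real \<times> real) set \<Rightarrow> (real \<times> real \<Rightarrow> real) \<Rightarrow> bool" where
  "Ck_on 0 S f \<longleftrightarrow> continuous_on S f"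
| "Ck_on (Suc k) S f \<longleftrightarrow>
     (\<forall>p\<in>S. f differentiable (at p)) \<and> Ck_on k S (partial_x f) \<and> Ck_on k S (partial_t f)"

definition smooth_on :: "(real \<times> real) set \<Rightarrow> (real \<times> real \<Rightarrow> real) \<Rightarrow> bool" where
  "smooth_on S f \<longleftrightarrow> (\<forall>k. Ck_on k S f)"

definition solves_system ::
    "real \<Rightarrow> (real \<times> real) set \<Rightarrow> (real \<times> real \<Rightarrow> real) \<Rightarrow> (real \<times> real \<Rightarrow> real) \<Rightarrow> bool" where
  "solves_system l \<Omega> w y \<longleftrightarrow>
     (\<forall>p\<in>\<Omega>.
        partial_t w p + 1/2 * (partial_x w p)\<^sup>2 + partial_x (partial_x (partial_x w)) p
          + 1/2 * l * (partial_x y p)\<^sup>2 = 0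
      \<and> partial_t y p + partial_x w p * partial_x y p + partial_x (partial_x (partial_x y)) p = 0)"

end

theory Submission
  imports Defs
begin

text \<open>
  Put \<open>u = w + e y\<close> and \<open>u' = w' + e y'\<close> with \<open>e\<^sup>2 = \<lambda>\<close>. The system becomes the potential KdV equation
  \<open>K(u) = u\<^sub>t + u\<^sub>x\<^sup>2/2 + u\<^sub>x\<^sub>x\<^sub>x = 0\<close>, and the hypotheses become
  \<open>u\<^sub>x + u'\<^sub>x = 2\<nu> - v\<^sup>2/12\<close> and
  \<open>u\<^sub>t + u'\<^sub>t = v v\<^sub>x\<^sub>x/6 - (u\<^sub>x\<^sup>2 + u'\<^sub>x\<^sup>2 + u\<^sub>x u'\<^sub>x)/3\<close> with \<open>v = u - u'\<close>.
  Differentiating the former twice gives \<open>u\<^sub>x\<^sub>x\<^sub>x + u'\<^sub>x\<^sub>x\<^sub>x = -(v v\<^sub>x\<^sub>x + v\<^sub>x\<^sup>2)/6\<close>; adding this to the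
  latter yields \<open>K(u) + K(u') = 0\<close> identically.
\<close>

lemma smooth_on_partial_x: "smooth_on S f \<Longrightarrow> smooth_on S (partial_x f)"
  unfolding smooth_on_def by (metis Ck_on.simps(2))

text \<open>\<open>deriv\<close> is meaningful only where a derivative exists. The first-order
  clause of \<open>Ck_on\<close> gives total differentiability, and composing with the horizontal
  line through \<open>p\<close> gives the partial derivative.\<close>

lemma has_partial_x:
  assumes "smooth_on S f" "p \<in> S"
  shows "((\<lambda>s. f (s, snd p)) has_real_derivative partial_x f p) (at (fst p))"
proof -
  have "Ck_on (Suc 0) S f"
    using assms(1) unfolding smooth_on_def by blast
  then have f: "f differentiable (at (fst p, snd p))"
    using assms(2) by simp
  have "(\<lambda>s. (s, snd p)) differentiable (at (fst p))"
    unfolding differentiable_def by (auto intro!: derivative_eq_intros)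
  then have "(f \<circ> (\<lambda>s. (s, snd p))) differentiable (at (fst p))"
    using f by (intro differentiable_chain_at) simp_all
  then show ?thesis
    by (simp add: partial_x_def o_def DERIV_deriv_iff_real_differentiable)
qed

text \<open>Openness of \<open>S\<close> makes an identity known only on \<open>S\<close> hold near
  \<open>fst p\<close> along the horizontal line through \<open>p\<close>, so it may be
  differentiated at \<open>p\<close>.\<close>

lemma partial_x_eqI:
  assumes "open S" "p \<in> S" "\<And>q. q \<in> S \<Longrightarrow> f q = g q"
    and "((\<lambda>s. g (s, snd p)) has_real_derivative d) (at (fst p))"
  shows "partial_x f p = d"
proof -
  have "open ((\<lambda>s. (s, snd p)) -` S)"
    using assms(1) by (intro open_vimage continuous_intros)
  then have "eventually (\<lambda>s. s \<in> (\<lambda>s. (s, snd p)) -` S) (nhds (fst p))"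
    using assms(2) by (intro eventually_nhds_in_open) simp_all
  then have "eventually (\<lambda>s. (s, snd p) \<in> S) (nhds (fst p))"
    by simp
  then have "eventually (\<lambda>s. f (s, snd p) = g (s, snd p)) (nhds (fst p))"
    by (rule eventually_mono) (rule assms(3))
  then have "((\<lambda>s. f (s, snd p)) has_real_derivative d) (at (fst p))"
    using assms(4) by (simp add: DERIV_cong_ev)
  then show ?thesis
    by (simp add: partial_x_def DERIV_imp_deriv)
qed

lemma partial_x_add:
  assumes "open S" "smooth_on S f" "smooth_on S g" "p \<in> S"
  shows "partial_x (\<lambda>q. f q + g q) p = partial_x f p + partial_x g p"
  using assms by (intro partial_x_eqI[OF assms(1,4) refl] DERIV_add has_partial_x)

lemma partial_x_diff:
  assumes "open S" "smooth_on S f" "smooth_on S g" "p \<in> S"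
  shows "partial_x (\<lambda>q. f q - g q) p = partial_x f p - partial_x g p"
  using assms by (intro partial_x_eqI[OF assms(1,4) refl] DERIV_diff has_partial_x)

lemma partial_x_partial_x_diff:
  assumes "open S" "smooth_on S f" "smooth_on S g" "p \<in> S"
  shows "partial_x (partial_x (\<lambda>q. f q - g q)) p
    = partial_x (partial_x f) p - partial_x (partial_x g) p"
  using assms
  by (intro partial_x_eqI[OF assms(1,4) partial_x_diff[OF assms(1-3)]] DERIV_diff
      has_partial_x smooth_on_partial_x)

text \<open>Each spatial hypothesis has the form \<open>F + F' = c - a (f - f') (g - g') - b (h - h')\<^sup>2\<close>;
  the \<open>y\<close>-equation is the case \<open>b = 0\<close>.\<close>

lemma partial_x_twice_Baecklund:
  fixes a b c :: real
  assumes S: "open S" "p \<in> S"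
    and smooth: "smooth_on S F" "smooth_on S F'" "smooth_on S f" "smooth_on S f'"
      "smooth_on S g" "smooth_on S g'" "smooth_on S h" "smooth_on S h'"
    and eq: "\<And>q. q \<in> S \<Longrightarrow>
      F q + F' q = c - a * ((f q - f' q) * (g q - g' q)) - b * (h q - h' q)\<^sup>2"
  shows "partial_x (partial_x F) p + partial_x (partial_x F') p
    = - a * ((partial_x (partial_x f) p - partial_x (partial_x f') p) * (g p - g' p)
          + 2 * ((partial_x f p - partial_x f' p) * (partial_x g p - partial_x g' p))
          + (f p - f' p) * (partial_x (partial_x g) p - partial_x (partial_x g') p))
      - 2 * b * ((partial_x h p - partial_x h' p)\<^sup>2
          + (h p - h' p) * (partial_x (partial_x h) p - partial_x (partial_x h') p))"
proof -
  note D = smooth[THEN has_partial_x] smooth[THEN smooth_on_partial_x, THEN has_partial_x]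
  \<comment> \<open>Needed on all of \<open>S\<close>, not only at \<open>p\<close>, since it is
    differentiated once more below.\<close>
  have first: "partial_x F q + partial_x F' q
      = - a * ((partial_x f q - partial_x f' q) * (g q - g' q)
            + (f q - f' q) * (partial_x g q - partial_x g' q))
        - 2 * b * ((h q - h' q) * (partial_x h q - partial_x h' q))" if q: "q \<in> S" for q
  proof -
    have "partial_x (\<lambda>q. F q + F' q) q
      = - a * ((partial_x f q - partial_x f' q) * (g q - g' q)
            + (f q - f' q) * (partial_x g q - partial_x g' q))
        - 2 * b * ((h q - h' q) * (partial_x h q - partial_x h' q))"
      by (rule partial_x_eqI[OF S(1) q eq], assumption)
        (auto intro!: derivative_eq_intros D[OF q] simp: algebra_simps)
    then show ?thesis
      using partial_x_add[OF S(1) smooth(1,2) q] by simp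
  qed
  have "partial_x (\<lambda>q. partial_x F q + partial_x F' q) p
    = - a * ((partial_x (partial_x f) p - partial_x (partial_x f') p) * (g p - g' p)
          + 2 * ((partial_x f p - partial_x f' p) * (partial_x g p - partial_x g' p))
          + (f p - f' p) * (partial_x (partial_x g) p - partial_x (partial_x g') p))
      - 2 * b * ((partial_x h p - partial_x h' p)\<^sup>2
          + (h p - h' p) * (partial_x (partial_x h) p - partial_x (partial_x h') p))"
    by (rule partial_x_eqI[OF S first], assumption)
      (auto intro!: derivative_eq_intros D[OF S(2)] simp: algebra_simps power2_eq_square)
  then show ?thesis
    using partial_x_add[OF S(1) smooth(1,2)[THEN smooth_on_partial_x] S(2)] by simp
qed

theorem theorem3:
  fixes l \<eta> \<mu> :: real and \<Omega> :: "(real \<times> real) set"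
    and w y w' y' :: "real \<times> real \<Rightarrow> real"
  assumes "open \<Omega>"
    and "smooth_on \<Omega> w" and "smooth_on \<Omega> y" and "smooth_on \<Omega> w'" and "smooth_on \<Omega> y'"
    and "\<And>p. p \<in> \<Omega> \<Longrightarrow>
      partial_x w p + partial_x w' p
        = 2 * \<eta> - 1/12 * (w p - w' p)\<^sup>2 - l/12 * (y p - y' p)\<^sup>2"
    and "\<And>p. p \<in> \<Omega> \<Longrightarrow>
      partial_t w p + partial_t w' p
        = 1/6 * (w p - w' p) * (partial_x (partial_x w) p - partial_x (partial_x w') p)
          + l/6 * (y p - y' p) * (partial_x (partial_x y) p - partial_x (partial_x y') p)
          - 1/3 * (partial_x w p)\<^sup>2 - 1/3 * (partial_x w' p)\<^sup>2
          - 1/3 * partial_x w p * partial_x w' p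
          - l/3 * (partial_x y p)\<^sup>2 - l/3 * (partial_x y' p)\<^sup>2
          - l/3 * partial_x y p * partial_x y' p"
    and "\<And>p. p \<in> \<Omega> \<Longrightarrow>
      partial_x y p + partial_x y' p = 2 * \<mu> - 1/6 * (w p - w' p) * (y p - y' p)"
    and "\<And>p. p \<in> \<Omega> \<Longrightarrow>
      partial_t y p + partial_t y' p
        = 1/6 * (w p - w' p) * partial_x (partial_x (\<lambda>q. y q - y' q)) p
          + 1/6 * partial_x (partial_x (\<lambda>q. w q - w' q)) p * (y p - y' p)
          - (2/3 * partial_x w p * partial_x y p + 2/3 * partial_x w' p * partial_x y' p
             + 1/3 * partial_x w p * partial_x y' p + 1/3 * partial_x w' p * partial_x y p)"
    and "solves_system l \<Omega> w' y'"
  shows "solves_system l \<Omega> w y"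
  unfolding solves_system_def
proof (intro ballI)
  fix p assume p: "p \<in> \<Omega>"
  note sm = assms(2-5)
  note sx = sm[THEN smooth_on_partial_x]
  \<comment> \<open>The \<open>e\<close>-free part of the twice differentiated equation for
    \<open>u\<close>: \<open>f = g = w\<close>, \<open>h = y\<close>, \<open>a = 1/12\<close>,
    \<open>b = l/12\<close>. Treating \<open>e\<close> as formal and working with its two components
    covers every sign of \<open>l\<close>.\<close>
  have w3: "partial_x (partial_x (partial_x w)) p + partial_x (partial_x (partial_x w')) p
    = - (1/12) * ((partial_x (partial_x w) p - partial_x (partial_x w') p) * (w p - w' p)
          + 2 * ((partial_x w p - partial_x w' p) * (partial_x w p - partial_x w' p))
          + (w p - w' p) * (partial_x (partial_x w) p - partial_x (partial_x w') p))
      - 2 * (l/12) * ((partial_x y p - partial_x y' p)\<^sup>2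
          + (y p - y' p) * (partial_x (partial_x y) p - partial_x (partial_x y') p))"
    by (rule partial_x_twice_Baecklund[OF assms(1) p, where c = "2 * \<eta>"])
      (use sm sx assms(6) in \<open>simp_all add: power2_eq_square\<close>)
  \<comment> \<open>The coefficient of \<open>e\<close>: \<open>f = w\<close>, \<open>g = y\<close>,
    \<open>a = 1/6\<close>, \<open>b = 0\<close>. The vanishing last term is written out so that the
    goal unifies with the lemma.\<close>
  have y3: "partial_x (partial_x (partial_x y)) p + partial_x (partial_x (partial_x y')) p
    = - (1/6) * ((partial_x (partial_x w) p - partial_x (partial_x w') p) * (y p - y' p)
          + 2 * ((partial_x w p - partial_x w' p) * (partial_x y p - partial_x y' p))
          + (w p - w' p) * (partial_x (partial_x y) p - partial_x (partial_x y') p))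
      - 2 * 0 * ((partial_x y p - partial_x y' p)\<^sup>2
          + (y p - y' p) * (partial_x (partial_x y) p - partial_x (partial_x y') p))"
    by (rule partial_x_twice_Baecklund[OF assms(1) p, where c = "2 * \<mu>"])
      (use sm sx assms(8) in simp_all)
  have wt: "partial_t w' p + 1/2 * (partial_x w' p)\<^sup>2 + partial_x (partial_x (partial_x w')) p
          + 1/2 * l * (partial_x y' p)\<^sup>2 = 0"
    and yt: "partial_t y' p + partial_x w' p * partial_x y' p
          + partial_x (partial_x (partial_x y')) p = 0"
    using assms(10) p unfolding solves_system_def by blast+
  \<comment> \<open>The \<open>t\<close>-equation for \<open>y\<close> has second derivatives of
    differences, \<open>y3\<close> differences of second derivatives.\<close>
  note dd = partial_x_partial_x_diff[OF assms(1) _ _ p]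
  \<comment> \<open>Adding \<open>w3\<close> to the \<open>t\<close>-equation cancels the
    second-order terms. The cross terms cancel as \<open>-1/3 + 2/6 = 0\<close>, and the squares get
    \<open>-1/3 - 1/6 = -1/2\<close>, as the system requires.\<close>
  have "partial_t w p + 1/2 * (partial_x w p)\<^sup>2 + partial_x (partial_x (partial_x w)) p
          + 1/2 * l * (partial_x y p)\<^sup>2 = 0"
    using assms(7)[OF p] w3 wt by (simp add: field_simps power2_eq_square)
  \<comment> \<open>Likewise the mixed products cancel as \<open>-1/3 + 1/3 = 0\<close>, and
    \<open>w_x y_x\<close> and \<open>w'_x y'_x\<close> get \<open>-2/3 - 1/3 = -1\<close>.\<close>
  moreover have "partial_t y p + partial_x w p * partial_x y p
      + partial_x (partial_x (partial_x y)) p = 0"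
    using assms(9)[OF p] y3 yt by (simp add: dd sm field_simps)
  ultimately show "partial_t w p + 1/2 * (partial_x w p)\<^sup>2 + partial_x (partial_x (partial_x w)) p
          + 1/2 * l * (partial_x y p)\<^sup>2 = 0
      \<and> partial_t y p + partial_x w p * partial_x y p + partial_x (partial_x (partial_x y)) p = 0"
    by blast
qed

end
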